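(* Let $Q\subset\mathbb{R}^2$ be a convex trapezoid (a nondegenerate convex quadrilateral having a pair of parallel opposite sides) of area $1$. Then for every $0\le t\le 1/4$ there are two orthogonal lines cutting $Q$ into four pieces whose areas, in cyclic order, are $$t,\quad t,\quad \tfrac12-t,\quad \tfrac12-t .$$
   Context: The pieces are the intersections of $Q$ with the four quadrant-shaped regions determined by the two orthogonal lines, listed in cyclic order around their intersection point. Convention: at $t=0$ the degenerate partition given by a single line halving the area is allowed. *)

theory Defs
  imports "HOL-Analysis.Analysis"
begin

definition convex_quadrilateral :: "(real^2) set \<Rightarrow> bool" where
  "convex_quadrilateral Q \<longleftrightarrow>
     polytope Q \<and> aff_dim Q = 2 \<and> card {x. x extreme_point_of Q} = 4"

text \<open>Two sides of a quadrilateral are opposite iff they share no vertex, i.e. are disjoint.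
  Only one parallel pair is demanded, so parallelograms are trapezoids.\<close>

definition trapezoid :: "(real^2) set \<Rightarrow> bool" where
  "trapezoid Q \<longleftrightarrow> convex_quadrilateral Q \<and>
     (\<exists>e f. e edge_of Q \<and> f edge_of Q \<and> e \<inter> f = {} \<and>
            affine_parallel (affine hull e) (affine hull f))"

definition orthogonal_lines :: "(real^2) set \<Rightarrow> (real^2) set \<Rightarrow> bool" where
  "orthogonal_lines L M \<longleftrightarrow>
     affine L \<and> aff_dim L = 1 \<and> affine M \<and> aff_dim M = 1 \<and>
     (\<forall>x\<in>L. \<forall>y\<in>L. \<forall>z\<in>M. \<forall>w\<in>M. orthogonal (x - y) (z - w))"

definition quadrant :: "real^2 \<Rightarrow> real^2 \<Rightarrow> real^2 \<Rightarrow> (real^2) set" where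
  "quadrant p u v = {p + a *\<^sub>R u + b *\<^sub>R v | a b. a \<ge> 0 \<and> b \<ge> 0}"

text \<open>For orthogonal lines \<open>L\<close> and \<open>M\<close>, \<open>p\<close> is their intersection point and
  \<open>u\<close>, \<open>v\<close> are directions of \<open>L\<close>, \<open>M\<close>. The rays from \<open>p\<close> in the directions
  \<open>u, v, -u, -v\<close> follow each other around \<open>p\<close>, and successive regions in the list share
  one of them. The orientation and the region listed first are left free.

  The regions are closed, so they overlap in null sets only. The point \<open>p\<close> need not lie in the
  figure being cut: if \<open>M\<close> misses it, the partition degenerates to the cut by the single line
  \<open>L\<close>, two of the four pieces being empty.\<close>

definition cyclic_quadrants ::
    "(real^2) set \<Rightarrow> (real^2) set \<Rightarrow> (real^2) set list \<Rightarrow> bool" where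
  "cyclic_quadrants L M Rs \<longleftrightarrow>
     (\<exists>p u v. p \<in> L \<inter> M \<and> u \<noteq> 0 \<and> v \<noteq> 0 \<and> p + u \<in> L \<and> p + v \<in> M \<and>
        Rs = [quadrant p u v, quadrant p v (- u), quadrant p (- u) (- v), quadrant p (- v) u])"

end

theory Submission imports Defs begin

text \<open>A trapezoid is preserved by the skew reflection along its parallel sides that swaps the end
  points of each of them. Take orthonormal coordinates with the first axis \<open>a\<close> along these sides,
  and let the fixed line of the reflection be \<open>X = m Y + k\<close> with \<open>m \<ge> 0\<close>. For an orthonormal frame
  \<open>(u, v)\<close> choose the line perpendicular to \<open>v\<close> that cuts off area \<open>2 t\<close> and the line perpendicular
  to \<open>u\<close> that halves the figure; all that is missing is that the second line also halves the cap.
  The area of the quadrant between \<open>u\<close> and \<open>v\<close> depends continuously on the frame. When \<open>v\<close> is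
  perpendicular to the parallel sides, this area is at least \<open>t\<close>, as the reflection shows. Reflecting
  the left cap to the right shows that it is at most \<open>t\<close> for \<open>v = a\<close> or for \<open>v = - a\<close>. The intermediate
  value theorem gives the desired frame.\<close>

subsection \<open>Areas of caps and wedges\<close>

text \<open>A half-plane is encoded by a normal and a threshold, so that both can vary continuously
  with a rotating frame.\<close>

definition cap_area :: "'a::euclidean_space set \<Rightarrow> 'a \<Rightarrow> real \<Rightarrow> real" where
  "cap_area S v s = measure lebesgue (S \<inter> {x. s \<le> v \<bullet> x})"

definition wedge_area :: "'a::euclidean_space set \<Rightarrow> 'a \<Rightarrow> real \<Rightarrow> 'a \<Rightarrow> real \<Rightarrow> real" where
  "wedge_area S v s u r = measure lebesgue (S \<inter> {x. s \<le> v \<bullet> x} \<inter> {x. r \<le> u \<bullet> x})"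

text \<open>Makes continuity of cap areas a special case of continuity of wedge areas.\<close>

lemma wedge_area_same: "wedge_area S v s v s = cap_area S v s"
  by (simp add: wedge_area_def cap_area_def Int_assoc)

lemma measure_mono_compact:
  fixes S T :: "'a::euclidean_space set"
  assumes "compact S" "compact T" "S \<subseteq> T"
  shows "measure lebesgue S \<le> measure lebesgue T"
  using assms by (intro measure_mono_fmeasurable) (auto simp: lmeasurable_compact fmeasurableD)

lemma compact_Int_halfspaces:
  fixes S :: "'a::euclidean_space set"
  assumes "compact S"
  shows "compact (S \<inter> {x. s \<le> v \<bullet> x})" "compact (S \<inter> {x. v \<bullet> x \<le> s})"
  using assms closed_halfspace_ge[of s v] closed_halfspace_le[of v s]
  by (auto simp: compact_Int_closed)

lemma measure_halfspace_split:
  fixes S :: "'a::euclidean_space set"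
  assumes "compact S" "v \<noteq> 0"
  shows "measure lebesgue S =
           measure lebesgue (S \<inter> {x. s \<le> v \<bullet> x}) + measure lebesgue (S \<inter> {x. v \<bullet> x \<le> s})"
proof -
  let ?A = "S \<inter> {x. s \<le> v \<bullet> x}" and ?B = "S \<inter> {x. v \<bullet> x \<le> s}"
  have "negligible (?A \<inter> ?B)"
    by (rule negligible_subset[OF negligible_hyperplane[of v s]]) (use assms in auto)
  moreover have "?A \<union> ?B = S" by auto
  ultimately show ?thesis
    using measure_Un3[of ?A lebesgue ?B] compact_Int_halfspaces[OF assms(1)]
    by (simp add: lmeasurable_compact negligible_imp_measure0)
qed

text \<open>Dominated convergence: the indicators of the wedges converge pointwise off the two
  limiting boundary hyperplanes, which are null sets, and the indicator of \<open>S\<close> bounds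
  them all.\<close>

lemma tendsto_wedge_area:
  fixes S :: "'a::euclidean_space set"
  assumes S: "compact S" and lim: "v \<longlonglongrightarrow> v0" "s \<longlonglongrightarrow> s0" "u \<longlonglongrightarrow> u0" "r \<longlonglongrightarrow> r0"
    and nz: "v0 \<noteq> 0" "u0 \<noteq> 0"
  shows "(\<lambda>n. wedge_area S (v n) (s n) (u n) (r n)) \<longlonglongrightarrow> wedge_area S v0 s0 u0 r0"
proof -
  define W where "W v s u r = S \<inter> {x. s \<le> v \<bullet> x} \<inter> {x. r \<le> u \<bullet> x}" for v s u r
  have W: "W v s u r \<in> lmeasurable" for v s u r
    unfolding W_def by (intro lmeasurable_compact compact_Int_halfspaces S)
  have "(\<lambda>n. integral\<^sup>L lebesgue (indicat_real (W (v n) (s n) (u n) (r n))))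
      \<longlonglongrightarrow> integral\<^sup>L lebesgue (indicat_real (W v0 s0 u0 r0))"
  proof (rule integral_dominated_convergence[where w = "indicat_real S"])
    show "integrable lebesgue (indicat_real S)"
      using lmeasurable_compact[OF S] by (simp add: lmeasurable_iff_integrable)
    show "AE x in lebesgue. (\<lambda>n. indicat_real (W (v n) (s n) (u n) (r n)) x)
            \<longlonglongrightarrow> indicat_real (W v0 s0 u0 r0) x"
    proof (rule AE_I'[of "{x. v0 \<bullet> x = s0} \<union> {x. u0 \<bullet> x = r0}"])
      show "{x. v0 \<bullet> x = s0} \<union> {x. u0 \<bullet> x = r0} \<in> null_sets lebesgue"
        using nz negligible_hyperplane by (metis negligible_Un negligible_iff_null_sets)
      have "(\<lambda>n. indicat_real (W (v n) (s n) (u n) (r n)) x) \<longlonglongrightarrow> indicat_real (W v0 s0 u0 r0) x"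
        if ne: "v0 \<bullet> x \<noteq> s0" "u0 \<bullet> x \<noteq> r0" for x
      proof (rule tendsto_eventually)
        \<comment> \<open>Off the limiting hyperplane \<open>w0 \<bullet> x - c0\<close> is nonzero,
          and nearby terms share its sign.\<close>
        have ev: "\<forall>\<^sub>F n in sequentially. (c n \<le> w n \<bullet> x) = (c0 \<le> w0 \<bullet> x)"
          if "w \<longlonglongrightarrow> w0" "c \<longlonglongrightarrow> c0" "w0 \<bullet> x \<noteq> c0" for w w0 and c :: "nat \<Rightarrow> real" and c0
        proof -
          have l: "(\<lambda>n. w n \<bullet> x - c n) \<longlonglongrightarrow> w0 \<bullet> x - c0"
            by (intro tendsto_intros that)
          show ?thesis
          proof (cases "w0 \<bullet> x - c0 > 0")
            case True
            show ?thesis using order_tendstoD(1)[OF l True] by eventually_elim (use True in auto)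
          next
            case False
            then have F: "w0 \<bullet> x - c0 < 0" using that by auto
            show ?thesis using order_tendstoD(2)[OF l F] by eventually_elim (use F in auto)
          qed
        qed
        show "\<forall>\<^sub>F n in sequentially.
          indicat_real (W (v n) (s n) (u n) (r n)) x = indicat_real (W v0 s0 u0 r0) x"
          using ev[OF lim(1,2) ne(1)] ev[OF lim(3,4) ne(2)]
          by eventually_elim (auto simp: W_def indicator_def)
      qed
      then show "{x \<in> space lebesgue. \<not> (\<lambda>n. indicat_real (W (v n) (s n) (u n) (r n)) x)
            \<longlonglongrightarrow> indicat_real (W v0 s0 u0 r0) x} \<subseteq> {x. v0 \<bullet> x = s0} \<union> {x. u0 \<bullet> x = r0}"
        by blast
    qed
    show "AE x in lebesgue. norm (indicat_real (W (v n) (s n) (u n) (r n)) x) \<le> indicat_real S x" for n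
      by (auto simp: W_def indicator_def)
  qed (use W in \<open>auto simp: fmeasurableD\<close>)
  then show ?thesis
    using W by (simp add: wedge_area_def W_def[symmetric] lmeasure_integral_UNIV fmeasurableD)
qed

lemma continuous_on_wedge_area:
  fixes S :: "'a::euclidean_space set" and v u :: "'b::{first_countable_topology,t2_space} \<Rightarrow> 'a"
  assumes S: "compact S" and cont: "continuous_on T v" "continuous_on T s"
      "continuous_on T u" "continuous_on T r"
    and nz: "\<And>z. z \<in> T \<Longrightarrow> v z \<noteq> 0" "\<And>z. z \<in> T \<Longrightarrow> u z \<noteq> 0"
  shows "continuous_on T (\<lambda>z. wedge_area S (v z) (s z) (u z) (r z))"
proof (rule continuous_on_sequentiallyI)
  fix z a assume z: "\<forall>n. z n \<in> T" "a \<in> T" "z \<longlonglongrightarrow> a"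
  show "(\<lambda>n. wedge_area S (v (z n)) (s (z n)) (u (z n)) (r (z n)))
          \<longlonglongrightarrow> wedge_area S (v a) (s a) (u a) (r a)"
    using nz z
    by (intro tendsto_wedge_area S continuous_on_tendsto_compose[OF cont(1) z(3,2)]
        continuous_on_tendsto_compose[OF cont(2) z(3,2)]
        continuous_on_tendsto_compose[OF cont(3) z(3,2)]
        continuous_on_tendsto_compose[OF cont(4) z(3,2)]) auto
qed

lemma continuous_on_cap_area:
  fixes S :: "'a::euclidean_space set" and v :: "'b::{first_countable_topology,t2_space} \<Rightarrow> 'a"
  assumes "compact S" "continuous_on T v" "continuous_on T s" "\<And>z. z \<in> T \<Longrightarrow> v z \<noteq> 0"
  shows "continuous_on T (\<lambda>z. cap_area S (v z) (s z))"
  using continuous_on_wedge_area[of S T v s v s] assms by (simp add: wedge_area_same)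

section \<open>Levels of caps of prescribed area: existence, uniqueness, continuity\<close>

lemma bounded_between_halfspaces:
  fixes S :: "'a::euclidean_space set"
  assumes "bounded S" obtains s where "s > 0" "S \<inter> {x. s \<le> v \<bullet> x} = {}" "S \<subseteq> {x. - s \<le> v \<bullet> x}"
proof -
  obtain B where B: "\<And>x. x \<in> S \<Longrightarrow> norm x \<le> B" using assms by (auto simp: bounded_iff)
  have *: "\<bar>v \<bullet> x\<bar> \<le> norm v * \<bar>B\<bar>" if "x \<in> S" for x
    by (rule order_trans[OF Cauchy_Schwarz_ineq2]) (use B[OF that] in \<open>auto intro!: mult_left_mono\<close>)
  show thesis
    by (rule that[of "norm v * \<bar>B\<bar> + 1"]) (use * in \<open>force simp: add_pos_nonneg add_nonneg_pos\<close>)+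
qed

text \<open>Intermediate value theorem between a level below all of \<open>S\<close> and a level
  above it.\<close>

lemma cap_area_exists:
  fixes S :: "'a::euclidean_space set"
  assumes S: "compact S" and v: "v \<noteq> 0" and c: "0 \<le> c" "c \<le> measure lebesgue S"
  shows "\<exists>s. cap_area S v s = c"
proof -
  obtain s where s: "s > 0" "S \<inter> {x. s \<le> v \<bullet> x} = {}" "S \<subseteq> {x. - s \<le> v \<bullet> x}"
    using bounded_between_halfspaces[OF compact_imp_bounded[OF S]] by metis
  have "S \<inter> {x. - s \<le> v \<bullet> x} = S" using s by auto
  then have "cap_area S v (- s) = measure lebesgue S" "cap_area S v s = 0"
    using s by (auto simp: cap_area_def)
  moreover have "continuous_on {-s..s} (cap_area S v)"
    by (rule continuous_on_cap_area[of S _ "\<lambda>_. v" "\<lambda>x. x"]) (use S v in \<open>auto intro: continuous_intros\<close>)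
  ultimately show ?thesis
    using IVT2'[of "cap_area S v" s c "-s"] s c by auto
qed

text \<open>Equal areas would make the slab between the two levels a null set. But \<open>S\<close>
  has positive measure above \<open>s'\<close> and below \<open>s\<close>, hence interior points on
  both sides, and the connected interior then meets the open slab.\<close>

lemma cap_area_strict_antimono:
  fixes S :: "'a::euclidean_space set"
  assumes S: "compact S" "convex S" and v: "v \<noteq> 0" and ss: "s < s'"
    and pos: "0 < cap_area S v s" and less: "cap_area S v s' < measure lebesgue S"
  shows "cap_area S v s' < cap_area S v s"
proof (rule ccontr)
  assume "\<not> ?thesis"
  moreover have "cap_area S v s' \<le> cap_area S v s"
    unfolding cap_area_def using ss
    by (intro measure_mono_compact compact_Int_halfspaces S) auto
  ultimately have eq: "cap_area S v s' = cap_area S v s" by simp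
  let ?K = "S \<inter> {x. s \<le> v \<bullet> x} \<inter> {x. v \<bullet> x \<le> s'}"
  have "compact (S \<inter> {x. s \<le> v \<bullet> x})" by (intro compact_Int_halfspaces S)
  moreover have "S \<inter> {x. s \<le> v \<bullet> x} \<inter> {x. s' \<le> v \<bullet> x} = S \<inter> {x. s' \<le> v \<bullet> x}" using ss by auto
  ultimately have K0: "measure lebesgue ?K = 0"
    using measure_halfspace_split[of "S \<inter> {x. s \<le> v \<bullet> x}" v s'] v eq by (simp add: cap_area_def)
  have Kl: "?K \<in> lmeasurable" by (intro lmeasurable_compact compact_Int_halfspaces S)
  \<comment> \<open>The frontier of a convex set is null, so a part of positive measure cannot lie
    inside it.\<close>
  have int: "\<exists>x \<in> interior S. x \<in> T" if "measure lebesgue (S \<inter> T) > 0" for T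
  proof (rule ccontr)
    assume "\<not> ?thesis"
    then have "S \<inter> T \<subseteq> frontier S" using S closure_subset[of S] by (auto simp: frontier_def)
    then have "negligible (S \<inter> T)"
      using negligible_convex_frontier[OF S(2)] negligible_subset by blast
    then show False using that negligible_imp_measure0 by force
  qed
  obtain x where x: "x \<in> interior S" "s' \<le> v \<bullet> x"
    using int[of "{x. s' \<le> v \<bullet> x}"] pos eq by (auto simp: cap_area_def)
  have "measure lebesgue (S \<inter> {x. v \<bullet> x \<le> s}) > 0"
    using measure_halfspace_split[OF S(1) v, of s] less eq by (simp add: cap_area_def)
  then obtain y where y: "y \<in> interior S" "v \<bullet> y \<le> s" using int by auto
  have "connected (interior S)" using S by (simp add: convex_connected)
  then obtain z where z: "z \<in> interior S" "v \<bullet> z = (s + s') / 2"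
    using connected_ivt_hyperplane[of "interior S" y x v "(s+s')/2"] x y ss by auto
  let ?U = "interior S \<inter> {x. s < v \<bullet> x} \<inter> {x. v \<bullet> x < s'}"
  have "open ?U" by (intro open_Int open_halfspace_gt open_halfspace_lt open_interior)
  moreover have "z \<in> ?U" using z ss by auto
  ultimately have "\<not> negligible ?U" using open_not_negligible by blast
  moreover have "?U \<subseteq> ?K" using interior_subset by fastforce
  ultimately have "\<not> negligible ?K" using negligible_subset by blast
  then show False using K0 Kl negligible_iff_measure by blast
qed

text \<open>For \<open>a\<close> on either side of \<open>s z\<close> the cap area at level
  \<open>a\<close> differs strictly from \<open>c\<close>. This persists for nearby directions, and
  monotonicity in the level keeps \<open>s y\<close> on the same side of \<open>a\<close>. At
  \<open>c = 0\<close> or at the full measure the level would not be unique.\<close>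

lemma continuous_on_cap_level:
  fixes S :: "'a::euclidean_space set" and v :: "'b::{first_countable_topology,t2_space} \<Rightarrow> 'a"
  assumes S: "compact S" "convex S" and v: "continuous_on T v" "\<And>z. z \<in> T \<Longrightarrow> v z \<noteq> 0"
    and c: "0 < c" "c < measure lebesgue S" and s: "\<And>z. z \<in> T \<Longrightarrow> cap_area S (v z) (s z) = c"
  shows "continuous_on T s"
  unfolding continuous_on_def
proof
  fix z assume z: "z \<in> T"
  have anti: "cap_area S w b \<le> cap_area S w a" if "a \<le> b" for a b w
    unfolding cap_area_def using that by (intro measure_mono_compact compact_Int_halfspaces S) auto
  have lim: "((\<lambda>y. cap_area S (v y) a) \<longlongrightarrow> cap_area S (v z) a) (at z within T)" for a
    using continuous_on_cap_area[OF S(1) v(1) continuous_on_const v(2)] z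
    by (auto simp: continuous_on_def)
  have inT: "\<forall>\<^sub>F y in at z within T. y \<in> T" by (simp add: eventually_at_topological) auto
  show "(s \<longlongrightarrow> s z) (at z within T)"
  proof (rule order_tendstoI)
    fix a assume "a < s z"
    then have "c < cap_area S (v z) a"
      using cap_area_strict_antimono[OF S v(2)[OF z], of a "s z"] anti[of a "s z" "v z"] s[OF z] c
      by auto
    from order_tendstoD(1)[OF lim this] inT
    show "\<forall>\<^sub>F y in at z within T. a < s y"
      by eventually_elim (use s anti in \<open>force simp: not_le[symmetric]\<close>)
  next
    fix a assume "s z < a"
    then have "cap_area S (v z) a < c"
      using cap_area_strict_antimono[OF S v(2)[OF z], of "s z" a] anti[of "s z" a "v z"] s[OF z] c
      by auto
    from order_tendstoD(2)[OF lim this] inT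
    show "\<forall>\<^sub>F y in at z within T. s y < a"
      by eventually_elim (use s anti in \<open>force simp: not_le[symmetric]\<close>)
  qed
qed

subsection \<open>Orthonormal frames\<close>

text \<open>A nonzero remainder would be orthogonal to \<open>a\<close> and \<open>b\<close>, giving
  three independent vectors in the plane.\<close>

lemma orthonormal_expand:
  fixes a b x :: "real^2"
  assumes ab: "norm a = 1" "norm b = 1" "a \<bullet> b = 0"
  shows "x = (a \<bullet> x) *\<^sub>R a + (b \<bullet> x) *\<^sub>R b"
proof (rule ccontr)
  have aa: "a \<bullet> a = 1" "b \<bullet> b = 1" "b \<bullet> a = 0"
    using ab by (simp_all add: norm_eq_1 inner_commute)
  define y where "y = x - (a \<bullet> x) *\<^sub>R a - (b \<bullet> x) *\<^sub>R b"
  assume "\<not> ?thesis"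
  then have y0: "y \<noteq> 0" by (auto simp: y_def algebra_simps)
  have y: "a \<bullet> y = 0" "b \<bullet> y = 0" using aa ab by (simp_all add: y_def inner_diff_right)
  have ne: "a \<noteq> b" "y \<noteq> a" "y \<noteq> b"
    using aa ab(3) y by (metis zero_neq_one)+
  have "independent {a, b, y}"
    using y y0 ab aa by (intro pairwise_orthogonal_independent)
      (auto simp: pairwise_def orthogonal_def inner_commute)
  then have "card {a, b, y} \<le> 2" using independent_bound[of "{a,b,y}"] by simp
  then show False using ne by simp
qed

lemma inner_orthonormal:
  fixes a b x y :: "real^2"
  assumes ab: "norm a = 1" "norm b = 1" "a \<bullet> b = 0"
  shows "x \<bullet> y = (a \<bullet> x) * (a \<bullet> y) + (b \<bullet> x) * (b \<bullet> y)"
  using arg_cong[OF orthonormal_expand[OF ab, of x], of "\<lambda>p. p \<bullet> y"]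
  by (simp only: inner_add_left inner_scaleR_left)

text \<open>Turns the parametric quadrant into an intersection of half-planes, so that its area
  becomes a \<open>wedge_area\<close>.\<close>

lemma quadrant_orthonormal:
  assumes ab: "norm u = 1" "norm v = 1" "u \<bullet> v = 0"
  shows "quadrant (r *\<^sub>R u + s *\<^sub>R v) u v = {x. r \<le> u \<bullet> x} \<inter> {x. s \<le> v \<bullet> x}"
proof -
  have aa: "u \<bullet> u = 1" "v \<bullet> v = 1" "v \<bullet> u = 0"
    using ab by (simp_all add: norm_eq_1 inner_commute)
  show ?thesis
  proof (intro equalityI subsetI)
    fix x assume "x \<in> quadrant (r *\<^sub>R u + s *\<^sub>R v) u v"
    then show "x \<in> {x. r \<le> u \<bullet> x} \<inter> {x. s \<le> v \<bullet> x}"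
      using aa ab by (auto simp: quadrant_def inner_add_right)
  next
    fix x assume x: "x \<in> {x. r \<le> u \<bullet> x} \<inter> {x. s \<le> v \<bullet> x}"
    have "r *\<^sub>R u + s *\<^sub>R v + (u \<bullet> x - r) *\<^sub>R u + (v \<bullet> x - s) *\<^sub>R v = x"
      using orthonormal_expand[OF ab, of x, symmetric] by (simp add: algebra_simps)
    then show "x \<in> quadrant (r *\<^sub>R u + s *\<^sub>R v) u v"
      unfolding quadrant_def mem_Collect_eq
      by (intro exI[of _ "u \<bullet> x - r"] exI[of _ "v \<bullet> x - s"] conjI)
        (use x in simp_all)
  qed
qed

lemma orthogonal_lines_orthonormal:
  fixes u v :: "real^2"
  assumes ab: "norm u = 1" "norm v = 1" "u \<bullet> v = 0"
  shows "orthogonal_lines {x. v \<bullet> x = s} {x. u \<bullet> x = r}"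
proof -
  have "u \<noteq> 0" "v \<noteq> 0" using ab by auto
  moreover have "orthogonal (x - y) (z - w)"
    if "v \<bullet> x = s" "v \<bullet> y = s" "u \<bullet> z = r" "u \<bullet> w = r" for x y z w
    using that unfolding orthogonal_def inner_orthonormal[OF ab, of "x - y" "z - w"]
    by (simp add: inner_diff_right)
  ultimately show ?thesis
    unfolding orthogonal_lines_def by (auto simp: affine_hyperplane)
qed

text \<open>Three areas determine all four: the cap leaves \<open>t\<close> for its other quadrant,
  and each half then leaves \<open>1/2 - t\<close> outside the cap.\<close>

lemma partition_from_wedge:
  fixes Q :: "(real^2) set"
  assumes Q: "compact Q" "measure lebesgue Q = 1"
    and ab: "norm u = 1" "norm v = 1" "u \<bullet> v = 0"
    and area: "cap_area Q v s = 2 * t" "cap_area Q u r = 1 / 2" "wedge_area Q v s u r = t"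
  shows "\<exists>L M Rs. orthogonal_lines L M \<and> cyclic_quadrants L M Rs \<and>
           map (\<lambda>R. measure lebesgue (Q \<inter> R)) Rs = [t, t, 1/2 - t, 1/2 - t]"
proof -
  define p where "p = r *\<^sub>R u + s *\<^sub>R v"
  have aa: "u \<bullet> u = 1" "v \<bullet> v = 1" "v \<bullet> u = 0" and nz: "u \<noteq> 0" "v \<noteq> 0"
    using ab by (auto simp: norm_eq_1 inner_commute)
  let ?ur = "{x. r \<le> u \<bullet> x}" and ?ul = "{x. u \<bullet> x \<le> r}"
    and ?vr = "{x. s \<le> v \<bullet> x}" and ?vl = "{x. v \<bullet> x \<le> s}"
  \<comment> \<open>The same description is applied to the frame after each quarter turn, with
    \<open>p\<close> rewritten in the turned frame.\<close>
  have q: "quadrant p u v = ?vr \<inter> ?ur" "quadrant p v (- u) = ?vr \<inter> ?ul"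
    "quadrant p (- u) (- v) = ?ul \<inter> ?vl" "quadrant p (- v) u = ?ur \<inter> ?vl"
    using quadrant_orthonormal[of u v r s] quadrant_orthonormal[of v "- u" s "- r"]
      quadrant_orthonormal[of "- u" "- v" "- r" "- s"] quadrant_orthonormal[of "- v" u "- s" r] ab aa
    by (auto simp: p_def add.commute)
  let ?Rs = "[quadrant p u v, quadrant p v (- u), quadrant p (- u) (- v), quadrant p (- v) u]"
  have "p \<in> {x. v \<bullet> x = s} \<inter> {x. u \<bullet> x = r}" "p + u \<in> {x. v \<bullet> x = s}" "p + v \<in> {x. u \<bullet> x = r}"
    using aa ab(3) by (simp_all add: p_def inner_add_right)
  then have "cyclic_quadrants {x. v \<bullet> x = s} {x. u \<bullet> x = r} ?Rs"
    unfolding cyclic_quadrants_def using nz by blast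
  moreover have "map (\<lambda>R. measure lebesgue (Q \<inter> R)) ?Rs = [t, t, 1/2 - t, 1/2 - t]"
  proof -
    note sp = measure_halfspace_split
    have "measure lebesgue (Q \<inter> ?vr \<inter> ?ul) = t"
      using sp[of "Q \<inter> ?vr" u r] area nz compact_Int_halfspaces[OF Q(1)]
      by (simp add: cap_area_def wedge_area_def)
    moreover have "measure lebesgue (Q \<inter> ?ur \<inter> ?vl) = 1/2 - t"
      using sp[of "Q \<inter> ?ur" v s] area nz compact_Int_halfspaces[OF Q(1)]
      by (simp add: cap_area_def wedge_area_def Int_ac)
    moreover have "measure lebesgue (Q \<inter> ?ul) = 1/2"
      using sp[OF Q(1) nz(1), of r] area Q by (simp add: cap_area_def)
    moreover have "measure lebesgue (Q \<inter> ?ul) =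
        measure lebesgue (Q \<inter> ?vr \<inter> ?ul) + measure lebesgue (Q \<inter> ?ul \<inter> ?vl)"
      using sp[of "Q \<inter> ?ul" v s] nz compact_Int_halfspaces[OF Q(1)] by (simp add: Int_ac)
    ultimately have "measure lebesgue (Q \<inter> ?ul \<inter> ?vl) = 1/2 - t"
      and "measure lebesgue (Q \<inter> ?vr \<inter> ?ul) = t" "measure lebesgue (Q \<inter> ?ur \<inter> ?vl) = 1/2 - t"
      by linarith+
    then show ?thesis
      using area by (simp only: q wedge_area_def Int_assoc list.map)
  qed
  ultimately show ?thesis
    by (intro exI conjI) (rule orthogonal_lines_orthonormal[OF ab])
qed

subsection \<open>Skew reflections\<close>

text \<open>For orthonormal \<open>a\<close>, \<open>b\<close> and coordinates
  \<open>X = a \<bullet> x\<close>, \<open>Y = b \<bullet> x\<close> this is the map sending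
  \<open>X\<close> to \<open>2 * (m * Y + k) - X\<close> and keeping \<open>Y\<close>: the affine
  involution parallel to \<open>a\<close> with axis \<open>X = m * Y + k\<close>.\<close>

definition skew_reflection :: "'a::euclidean_space \<Rightarrow> 'a \<Rightarrow> real \<Rightarrow> real \<Rightarrow> 'a \<Rightarrow> 'a" where
  "skew_reflection a b m k x = x + (2 * (m * (b \<bullet> x) + k - a \<bullet> x)) *\<^sub>R a"

lemma inner_skew_reflection:
  assumes "norm a = 1" "a \<bullet> b = 0"
  shows "a \<bullet> skew_reflection a b m k x = 2 * (m * (b \<bullet> x) + k) - a \<bullet> x"
    and "b \<bullet> skew_reflection a b m k x = b \<bullet> x"
  using assms by (simp_all add: skew_reflection_def inner_add_right norm_eq_1 inner_commute)

lemma skew_reflection_invol: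
  assumes "norm a = 1" "a \<bullet> b = 0"
  shows "skew_reflection a b m k (skew_reflection a b m k x) = x"
  unfolding skew_reflection_def[of _ _ _ _ "skew_reflection a b m k x"] inner_skew_reflection[OF assms]
  by (simp add: skew_reflection_def flip: scaleR_add_left)

text \<open>Splits off the linear part, for which measures and convex hulls of images are
  known.\<close>

lemma skew_reflection_translate:
  "skew_reflection a b m k x = (2 * k) *\<^sub>R a + skew_reflection a b m 0 x"
  by (simp add: skew_reflection_def algebra_simps)

lemma linear_skew_reflection: "linear (skew_reflection a b m 0)"
  by (rule linearI) (simp_all add: skew_reflection_def inner_add_right algebra_simps)

text \<open>The linear part is an involution, so its determinant squares to
  \<open>1\<close>.\<close>

lemma measure_skew_reflection:
  fixes a b :: "real^'n::{finite,wellorder}"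
  assumes ab: "norm a = 1" "a \<bullet> b = 0" and S: "compact S"
  shows "measure lebesgue (skew_reflection a b m k ` S) = measure lebesgue S"
proof -
  let ?f = "skew_reflection a b m 0"
  have "?f \<circ> ?f = id" using skew_reflection_invol[OF ab] by auto
  then have "det (matrix ?f) * det (matrix ?f) = 1"
    using matrix_compose[OF linear_skew_reflection linear_skew_reflection, of a b m a b m]
    by (metis det_mul matrix_id)
  then have d: "\<bar>det (matrix ?f)\<bar> = 1" by (auto simp: square_eq_1_iff)
  have "skew_reflection a b m k ` S = (+) ((2 * k) *\<^sub>R a) ` ?f ` S"
    by (simp add: skew_reflection_translate[of _ _ _ k] image_image)
  then show ?thesis
    using measure_translation[of "(2 * k) *\<^sub>R a" "?f ` S"]
      measure_linear_image[OF linear_skew_reflection lmeasurable_compact[OF S], of a b m] d by simp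
qed

text \<open>The sign condition on \<open>m\<close> makes the axis move weakly in direction
  \<open>a\<close> as the height \<open>b \<bullet> x\<close> grows. It can be arranged by negating
  \<open>a\<close>, \<open>m\<close> and \<open>k\<close> together.\<close>

locale skew_symmetric_body =
  fixes Q :: "(real^2) set" and a b :: "real^2" and m k :: real
  assumes Q: "compact Q" "convex Q" "measure lebesgue Q = 1"
    and ab: "norm a = 1" "norm b = 1" "a \<bullet> b = 0" and m: "m \<ge> 0"
    and invariant: "\<And>x. x \<in> Q \<Longrightarrow> skew_reflection a b m k x \<in> Q"
begin

abbreviation "\<sigma> \<equiv> skew_reflection a b m k"

section \<open>Area comparisons by the reflection\<close>

lemma measure_\<sigma>_le:
  assumes "compact A" "compact B" "\<And>x. x \<in> A \<Longrightarrow> \<sigma> x \<in> B"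
  shows "measure lebesgue A \<le> measure lebesgue B"
proof -
  have "continuous_on A \<sigma>"
    unfolding skew_reflection_def by (intro continuous_intros)
  then have "measure lebesgue (\<sigma> ` A) \<le> measure lebesgue B"
    using assms by (intro measure_mono_compact compact_continuous_image) auto
  then show ?thesis using measure_skew_reflection[OF ab(1,3) assms(1)] by simp
qed

lemma measure_\<sigma>_eq:
  assumes "compact A" "compact B" "\<And>x. x \<in> A \<Longrightarrow> \<sigma> x \<in> B" "\<And>x. x \<in> B \<Longrightarrow> \<sigma> x \<in> A"
  shows "measure lebesgue A = measure lebesgue B"
  using measure_\<sigma>_le[of A B] measure_\<sigma>_le[of B A] assms by (simp add: antisym)

lemmas inner_\<sigma> = inner_skew_reflection[OF ab(1,3), of m k]

lemma axes_nonzero: "a \<noteq> 0" "b \<noteq> 0"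
  using ab by auto

text \<open>It suffices that the right part of the cap is at least as large as the left part, since
  together they have area \<open>2 * t\<close>.\<close>

lemma wedge_upright_ge:
  assumes s: "cap_area Q b s = 2 * t" and r: "cap_area Q a r = 1 / 2"
  shows "t \<le> wedge_area Q b s a r"
proof -
  let ?ar = "{x. r \<le> a \<bullet> x}" and ?al = "{x. a \<bullet> x \<le> r}"
    and ?br = "{x. s \<le> b \<bullet> x}" and ?bl = "{x. b \<bullet> x \<le> s}"
  note C = compact_Int_halfspaces
  have cap: "2 * t = wedge_area Q b s a r + measure lebesgue (Q \<inter> ?br \<inter> ?al)"
    using measure_halfspace_split[of "Q \<inter> ?br" a r] axes_nonzero C[OF Q(1)] s
    by (simp add: cap_area_def wedge_area_def)
  have right: "1 / 2 = wedge_area Q b s a r + measure lebesgue (Q \<inter> ?ar \<inter> ?bl)"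
    using measure_halfspace_split[of "Q \<inter> ?ar" b s] axes_nonzero C[OF Q(1)] r
    by (simp add: cap_area_def wedge_area_def Int_ac)
  have "measure lebesgue (Q \<inter> ?al) = 1/2"
    using measure_halfspace_split[OF Q(1) axes_nonzero(1), of r] r Q by (simp add: cap_area_def)
  then have left: "1 / 2 = measure lebesgue (Q \<inter> ?br \<inter> ?al) + measure lebesgue (Q \<inter> ?bl \<inter> ?al)"
    using measure_halfspace_split[of "Q \<inter> ?al" b s] axes_nonzero C[OF Q(1)] by (simp add: Int_ac)
  show ?thesis
  \<comment> \<open>The axis crosses the boundary of the cap at abscissa \<open>m * s + k\<close>.
    If this is not left of \<open>r\<close>, then by \<open>m \<ge> 0\<close> the axis stays weakly
    right of \<open>r\<close> throughout the cap, and \<open>\<sigma>\<close> carries the left part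
    of the cap into the right one.\<close>
  proof (cases "r \<le> m * s + k")
    case True
    have "measure lebesgue (Q \<inter> ?br \<inter> ?al) \<le> measure lebesgue (Q \<inter> ?br \<inter> ?ar)"
    proof (rule measure_\<sigma>_le)
      fix x assume x: "x \<in> Q \<inter> ?br \<inter> ?al"
      then have "m * s \<le> m * (b \<bullet> x)" using m by (simp add: mult_left_mono)
      then show "\<sigma> x \<in> Q \<inter> ?br \<inter> ?ar" using x True by (simp add: invariant inner_\<sigma>)
    qed (intro C Q)+
    then show ?thesis using cap by (simp add: wedge_area_def)
  next
    case False
    txt \<open>The reflection now compares the parts below the cap; both halves having area \<open>1/2\<close>, this
      decides the comparison inside the cap.\<close>
    have "measure lebesgue (Q \<inter> ?bl \<inter> ?ar) \<le> measure lebesgue (Q \<inter> ?bl \<inter> ?al)"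
    proof (rule measure_\<sigma>_le)
      fix x assume x: "x \<in> Q \<inter> ?bl \<inter> ?ar"
      then have "m * (b \<bullet> x) \<le> m * s" using m by (simp add: mult_left_mono)
      then show "\<sigma> x \<in> Q \<inter> ?bl \<inter> ?al" using x False by (simp add: invariant inner_\<sigma>)
    qed (intro C Q)+
    then show ?thesis using cap left right by (simp add: Int_ac)
  qed
qed

text \<open>The two wedges, the right cap below the halving line and the left cap above it, have
  total area at most \<open>2 * t\<close>; hence one of them is at most \<open>t\<close>.\<close>

lemma wedge_sideways_le:
  assumes c: "cap_area Q a c = 2 * t" and r: "cap_area Q (- b) r = 1 / 2"
    and d: "cap_area Q (- a) d = 2 * t" and r': "cap_area Q b r' = 1 / 2"
  shows "wedge_area Q a c (- b) r \<le> t \<or> wedge_area Q (- a) d b r' \<le> t"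
proof -
  have half: "cap_area Q b (- r) = 1 / 2"
    using measure_halfspace_split[OF Q(1) axes_nonzero(2), of "- r"] r Q(3)
    by (simp add: cap_area_def minus_le_iff le_minus_iff)
  \<comment> \<open>Both frames have the same halving line: by strict monotonicity the halving level
    for \<open>b\<close> is unique.\<close>
  have "r' = - r"
    using cap_area_strict_antimono[OF Q(1,2) axes_nonzero(2), of r' "- r"]
      cap_area_strict_antimono[OF Q(1,2) axes_nonzero(2), of "- r" r'] half r' Q(3) by force
  define h where "h = - r"
  let ?A = "{x. c \<le> a \<bullet> x}" and ?L = "{x. a \<bullet> x \<le> - d}"
    and ?br = "{x. h \<le> b \<bullet> x}" and ?bl = "{x. b \<bullet> x \<le> h}"
  note C = compact_Int_halfspaces
  txt \<open>Reflecting the left cap \<open>?L\<close> gives the cap \<open>?E\<close> on the right. Below height \<open>h\<close> or above it,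
    depending on where the boundary lines of \<open>?A\<close> and \<open>?E\<close> cross, one of the two contains the other.\<close>
  define e where "e = a - (2 * m) *\<^sub>R b"
  let ?E = "{x. 2 * k + d \<le> e \<bullet> x}"
  \<comment> \<open>The normal \<open>e\<close> and the threshold arise by solving
    \<open>2 * (m * (b \<bullet> x) + k) - a \<bullet> x \<le> - d\<close> for the terms in
    \<open>x\<close>.\<close>
  have E: "2 * k + d \<le> e \<bullet> x \<longleftrightarrow> a \<bullet> \<sigma> x \<le> - d" for x
    unfolding inner_\<sigma> e_def by (auto simp: inner_diff_left)
  have refl: "measure lebesgue (Q \<inter> ?L \<inter> H) = measure lebesgue (Q \<inter> ?E \<inter> H)"
    if "compact (Q \<inter> ?L \<inter> H)" "compact (Q \<inter> ?E \<inter> H)" "\<And>x. \<sigma> x \<in> H \<longleftrightarrow> x \<in> H" for H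
    using that by (intro measure_\<sigma>_eq) (auto simp: E invariant skew_reflection_invol[OF ab(1,3)])
  have top: "measure lebesgue (Q \<inter> ?L \<inter> ?br) = measure lebesgue (Q \<inter> ?E \<inter> ?br)"
    and bot: "measure lebesgue (Q \<inter> ?L \<inter> ?bl) = measure lebesgue (Q \<inter> ?E \<inter> ?bl)"
    by (intro refl C Q; simp add: inner_\<sigma>)+
  have w: "wedge_area Q a c (- b) r = measure lebesgue (Q \<inter> ?A \<inter> ?bl)"
    "wedge_area Q (- a) d b r' = measure lebesgue (Q \<inter> ?L \<inter> ?br)"
    unfolding wedge_area_def \<open>r' = - r\<close> h_def by (simp_all add: le_minus_iff)
  have sA: "2 * t = measure lebesgue (Q \<inter> ?A \<inter> ?br) + measure lebesgue (Q \<inter> ?A \<inter> ?bl)"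
    using measure_halfspace_split[of "Q \<inter> ?A" b h] axes_nonzero C[OF Q(1)] c by (simp add: cap_area_def)
  have sL: "2 * t = measure lebesgue (Q \<inter> ?L \<inter> ?br) + measure lebesgue (Q \<inter> ?L \<inter> ?bl)"
    using measure_halfspace_split[OF C(2)[OF Q(1)] axes_nonzero(2), of a "- d" h] d
    by (simp add: cap_area_def le_minus_iff)
  show ?thesis
  \<comment> \<open>The right-hand side is the abscissa of the boundary of \<open>?E\<close> at
    height \<open>h\<close>. That boundary moves weakly to the right with height, so its comparison
    with \<open>c\<close> persists above \<open>h\<close> in the first case and below
    \<open>h\<close> in the second.\<close>
  proof (cases "c \<le> 2 * k + d + 2 * (m * h)")
    case True
    have "measure lebesgue (Q \<inter> ?E \<inter> ?br) \<le> measure lebesgue (Q \<inter> ?A \<inter> ?br)"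
    proof (rule measure_mono_compact; (intro C Q)?)
      have "c \<le> a \<bullet> x" if "h \<le> b \<bullet> x" "2 * k + d \<le> e \<bullet> x" for x
        using that True mult_left_mono[OF that(1) m] by (simp add: e_def inner_diff_left)
      then show "Q \<inter> ?E \<inter> ?br \<subseteq> Q \<inter> ?A \<inter> ?br" by auto
    qed
    then show ?thesis using top w sA by linarith
  next
    case False
    have "measure lebesgue (Q \<inter> ?A \<inter> ?bl) \<le> measure lebesgue (Q \<inter> ?E \<inter> ?bl)"
    proof (rule measure_mono_compact; (intro C Q)?)
      have "2 * k + d \<le> e \<bullet> x" if "b \<bullet> x \<le> h" "c \<le> a \<bullet> x" for x
        using that False mult_left_mono[OF that(1) m] by (simp add: e_def inner_diff_left)
      then show "Q \<inter> ?A \<inter> ?bl \<subseteq> Q \<inter> ?E \<inter> ?bl" by auto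
    qed
    then show ?thesis using bot w sL by linarith
  qed
qed

text \<open>The frame is rotated: angle \<open>0\<close> gives the upright position, and
  \<open>pi/2\<close> and \<open>-(pi/2)\<close> give the two sideways ones. Positivity of
  \<open>t\<close> keeps the cap area \<open>2 * t\<close> strictly between \<open>0\<close> and
  \<open>1\<close>, as continuity of the level requires.\<close>

lemma wedge_exists:
  assumes t: "0 < t" "t \<le> 1/4"
  shows "\<exists>u v s r. norm u = 1 \<and> norm v = 1 \<and> u \<bullet> v = 0 \<and> cap_area Q v s = 2 * t \<and>
           cap_area Q u r = 1 / 2 \<and> wedge_area Q v s u r = t"
proof -
  define v where "v \<theta> = cos \<theta> *\<^sub>R b + sin \<theta> *\<^sub>R a" for \<theta>
  define u where "u \<theta> = cos \<theta> *\<^sub>R a - sin \<theta> *\<^sub>R b" for \<theta>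
  have inner: "a \<bullet> a = 1" "b \<bullet> b = 1" "b \<bullet> a = 0"
    using ab by (simp_all add: norm_eq_1 inner_commute)
  have uv: "norm (u \<theta>) = 1" "norm (v \<theta>) = 1" "u \<theta> \<bullet> v \<theta> = 0" for \<theta>
    using inner ab(3)
    by (simp_all add: u_def v_def norm_eq_1 inner_add_left inner_add_right inner_diff_left
        inner_diff_right flip: power2_eq_square)
  then have uvnz: "u \<theta> \<noteq> 0" "v \<theta> \<noteq> 0" for \<theta> by (metis norm_zero zero_neq_one)+
  have cont: "continuous_on UNIV u" "continuous_on UNIV v"
    unfolding u_def v_def by (intro continuous_intros)+
  have "\<exists>s. cap_area Q (v \<theta>) s = 2 * t" "\<exists>r. cap_area Q (u \<theta>) r = 1 / 2" for \<theta>
    by (intro cap_area_exists Q uvnz; use t Q(3) in simp)+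
  \<comment> \<open>The levels are chosen separately for each angle; their continuity comes from
    uniqueness.\<close>
  then obtain s r where s: "\<And>\<theta>. cap_area Q (v \<theta>) (s \<theta>) = 2 * t"
    and r: "\<And>\<theta>. cap_area Q (u \<theta>) (r \<theta>) = 1 / 2" by metis
  have "continuous_on UNIV s" "continuous_on UNIV r"
    by (rule continuous_on_cap_level[OF Q(1,2) cont(2) uvnz(2), of "2 * t"]
        continuous_on_cap_level[OF Q(1,2) cont(1) uvnz(1), of "1 / 2"]; use s r t Q in simp)+
  define f where "f \<theta> = wedge_area Q (v \<theta>) (s \<theta>) (u \<theta>) (r \<theta>)" for \<theta>
  have cf: "continuous_on UNIV f"
    unfolding f_def by (intro continuous_on_wedge_area Q cont uvnz) fact+
  have ang: "v 0 = b" "u 0 = a" "v (pi/2) = a" "u (pi/2) = - b" "v (-(pi/2)) = - a" "u (-(pi/2)) = b"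
    by (simp_all add: u_def v_def)
  have up: "t \<le> f 0"
    using wedge_upright_ge[of "s 0" t "r 0"] s[of 0] r[of 0] by (simp add: f_def ang)
  have "f (pi/2) \<le> t \<or> f (-(pi/2)) \<le> t"
    using wedge_sideways_le[of "s (pi/2)" t "r (pi/2)" "s (-(pi/2))" "r (-(pi/2))"]
      s[of "pi/2"] r[of "pi/2"] s[of "-(pi/2)"] r[of "-(pi/2)"]
    by (simp only: f_def ang)
  \<comment> \<open>Which sideways position works is irrelevant, since the range of \<open>f\<close>
    over all angles is connected.\<close>
  then obtain \<phi> where "f \<phi> \<le> t" by blast
  moreover have "connected (range f)" using connected_continuous_image[OF cf] by simp
  ultimately have "t \<in> range f"
    using up connectedD_interval[of "range f" "f \<phi>" "f 0" t] by auto
  then obtain \<theta> where "f \<theta> = t" by auto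
  then show ?thesis using uv s r unfolding f_def by blast
qed

lemma partition_exists:
  assumes t: "0 \<le> t" "t \<le> 1/4"
  shows "\<exists>L M Rs. orthogonal_lines L M \<and> cyclic_quadrants L M Rs \<and>
           map (\<lambda>R. measure lebesgue (Q \<inter> R)) Rs = [t, t, 1/2 - t, 1/2 - t]"
proof (cases "t = 0")
  case True
  \<comment> \<open>Degenerate partition: one line lies beyond \<open>Q\<close>, and the other alone
    halves it.\<close>
  obtain s where s: "s > 0" "Q \<inter> {x. s \<le> b \<bullet> x} = {}"
    using bounded_between_halfspaces[OF compact_imp_bounded[OF Q(1)]] by metis
  obtain r where r: "cap_area Q a r = 1 / 2"
    using cap_area_exists[OF Q(1) axes_nonzero(1), of "1 / 2"] Q(3) by auto
  show ?thesis
    by (rule partition_from_wedge[of Q a b s _ r]) (use Q ab s r True in \<open>simp_all add: cap_area_def wedge_area_def\<close>)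
next
  case False
  then show ?thesis using wedge_exists[of t] partition_from_wedge[OF Q(1,3)] t by fastforce
qed

end

subsection \<open>Trapezoids\<close>

lemma skew_reflection_minus: "skew_reflection (- a) b (- m) (- k) = skew_reflection a b m k"
  by (simp add: skew_reflection_def fun_eq_iff algebra_simps)

text \<open>Being affine, the reflection preserves \<open>Q\<close> as soon as it permutes the
  vertices.\<close>

lemma skew_reflection_convex_hull:
  "skew_reflection a b m k ` (convex hull V) = convex hull (skew_reflection a b m k ` V)"
proof -
  have *: "skew_reflection a b m k ` X = (+) ((2 * k) *\<^sub>R a) ` skew_reflection a b m 0 ` X" for X
    by (simp add: skew_reflection_translate[of _ _ _ k] image_image)
  show ?thesis
    unfolding * by (simp add: convex_hull_linear_image[OF linear_skew_reflection] convex_hull_translation)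
qed

text \<open>The hypothesis \<open>mid\<close> says that the midpoint of \<open>p\<close> and
  \<open>q\<close>, which has the same height as both, lies on the axis.\<close>

lemma skew_reflection_swap:
  assumes ab: "norm a = 1" "norm b = 1" "a \<bullet> b = 0"
    and level: "b \<bullet> p = b \<bullet> q" and mid: "2 * (m * (b \<bullet> p) + k) = a \<bullet> p + a \<bullet> q"
  shows "skew_reflection a b m k p = (q :: real^2)"
proof -
  have "q - p = (a \<bullet> (q - p)) *\<^sub>R a + (b \<bullet> (q - p)) *\<^sub>R b"
    by (rule orthonormal_expand[OF ab])
  moreover have "b \<bullet> (q - p) = 0" using level by (simp add: inner_diff_right)
  moreover have "2 * (m * (b \<bullet> p) + k - a \<bullet> p) = a \<bullet> (q - p)"
    using mid by (simp add: inner_diff_right)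
  ultimately show ?thesis
    by (metis add.commute add.right_neutral diff_add_cancel scaleR_zero_left skew_reflection_def)
qed

lemma edge_of_polytope_segment:
  assumes "polytope Q" "e edge_of Q"
  obtains p q where "p \<noteq> q" "e = closed_segment p q"
proof -
  have e: "e face_of Q" "aff_dim e = 1" using assms by (auto simp: edge_of_def)
  then have "polytope e" using assms face_of_polytope_polytope by blast
  then have "compact e" "convex e" by (auto simp: polytope_imp_compact polytope_imp_convex)
  moreover have "e \<noteq> {}" using e by auto
  moreover have "collinear e" using e by (simp add: collinear_aff_dim)
  ultimately obtain p q where pq: "e = closed_segment p q"
    using compact_convex_collinear_segment by metis
  moreover have "p \<noteq> q" using pq e by auto
  ultimately show thesis using that by blast
qed

text \<open>The end points of two disjoint edges are four distinct extreme points, hence all of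
  them, and Krein-Milman recovers \<open>Q\<close>. The sign of \<open>\<mu>\<close> stays open, as
  the two sides are not oriented consistently.\<close>

lemma trapezoid_vertices:
  assumes "trapezoid Q"
  obtains p q c d \<mu> where "p \<noteq> q" "d - c = \<mu> *\<^sub>R (q - p)" "Q = convex hull {p, q, c, d}"
proof -
  have Q: "polytope Q" "card {x. x extreme_point_of Q} = 4"
    using assms by (auto simp: trapezoid_def convex_quadrilateral_def)
  obtain e f where ef: "e edge_of Q" "f edge_of Q" "e \<inter> f = {}"
    "affine_parallel (affine hull e) (affine hull f)"
    using assms by (auto simp: trapezoid_def)
  obtain p q where pq: "p \<noteq> q" "e = closed_segment p q"
    using edge_of_polytope_segment Q ef by metis
  obtain c d where cd: "c \<noteq> d" "f = closed_segment c d"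
    using edge_of_polytope_segment Q ef by metis
  have "{p, q, c, d} \<subseteq> {x. x extreme_point_of Q}"
    using extreme_point_of_face[of e Q] extreme_point_of_face[of f Q] ef(1,2) pq cd
    by (auto simp: edge_of_def extreme_point_of_segment)
  moreover have "card {p, q, c, d} = 4"
    using pq cd ef(3) ends_in_segment[of p q] ends_in_segment[of c d] by (auto simp: card_insert_if)
  moreover have "finite {x. x extreme_point_of Q}" using Q(2) card.infinite by fastforce
  ultimately have "{x. x extreme_point_of Q} = {p, q, c, d}"
    using Q(2) card_subset_eq by metis
  then have "Q = convex hull {p, q, c, d}"
    using Krein_Milman_Minkowski[of Q] Q(1) by (simp add: polytope_imp_compact polytope_imp_convex)
  moreover obtain \<mu> where "d - c = \<mu> *\<^sub>R (q - p)"
  proof -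
    obtain w where "affine hull {c, d} = (\<lambda>x. w + x) ` (affine hull {p, q})"
      using ef(4) pq cd by (auto simp: affine_parallel_def segment_convex_hull)
    moreover have "c \<in> affine hull {c, d}" "d \<in> affine hull {c, d}" by (auto intro: hull_inc)
    \<comment> \<open>Both \<open>c\<close> and \<open>d\<close> are translates by the same
      \<open>w\<close> of points on the line through \<open>p\<close> and \<open>q\<close>;
      \<open>w\<close> cancels in the difference.\<close>
    ultimately obtain x y where "c = w + (p + x *\<^sub>R (q - p))" "d = w + (p + y *\<^sub>R (q - p))"
      unfolding affine_hull_2_alt[of p q] by blast
    then have "d - c = (y - x) *\<^sub>R (q - p)"
      by (simp only:) (simp add: algebra_simps)
    then show thesis by (rule that)
  qed
  ultimately show thesis using that pq by blast
qed

text \<open>The axis is the line through the midpoints of the two parallel sides.\<close>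

lemma trapezoid_skew_symmetric:
  assumes "trapezoid Q" "measure lebesgue Q = 1"
  shows "\<exists>a b m k. skew_symmetric_body Q a b m k"
proof -
  have Q: "compact Q" "convex Q" "aff_dim Q = 2"
    using assms by (auto simp: trapezoid_def convex_quadrilateral_def polytope_imp_compact polytope_imp_convex)
  obtain p q c d \<mu> where pq: "p \<noteq> q" and par: "d - c = \<mu> *\<^sub>R (q - p)"
    and hull: "Q = convex hull {p, q, c, d}"
    using trapezoid_vertices[OF assms(1)] by metis
  define a where "a = (q - p) /\<^sub>R norm (q - p)"
  obtain b' where b': "b' \<noteq> 0" "orthogonal (q - p) b'"
    using orthogonal_to_vector_exists[of "q - p"] by auto
  define b where "b = b' /\<^sub>R norm b'"
  have ab: "norm a = 1" "norm b = 1" "a \<bullet> b = 0"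
    using pq b' by (auto simp: a_def b_def orthogonal_def)
  have "b \<bullet> (q - p) = 0" using b' by (simp add: b_def orthogonal_def inner_commute)
  moreover from this have "b \<bullet> (d - c) = 0" by (simp add: par)
  ultimately have level: "b \<bullet> p = b \<bullet> q" "b \<bullet> c = b \<bullet> d" by (simp_all add: inner_diff_right)
  \<comment> \<open>Otherwise all vertices, and with them \<open>Q\<close>, would lie on one line.
    This makes the denominator of \<open>m\<close> nonzero.\<close>
  have distinct: "b \<bullet> c \<noteq> b \<bullet> p"
  proof
    assume "b \<bullet> c = b \<bullet> p"
    then have "Q \<subseteq> {x. b \<bullet> x = b \<bullet> p}"
      unfolding hull using level by (intro hull_minimal convex_hyperplane) auto
    then have "aff_dim Q \<le> aff_dim {x. b \<bullet> x = b \<bullet> p}" by (rule aff_dim_subset)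
    moreover have "b \<noteq> 0" using ab by auto
    ultimately show False using Q(3) by simp
  qed
  \<comment> \<open>\<open>m\<close> and \<open>k\<close> solve the two equations putting the
    midpoints of the parallel sides on the axis.\<close>
  define m where "m = ((a \<bullet> c + a \<bullet> d) - (a \<bullet> p + a \<bullet> q)) / (2 * (b \<bullet> c - b \<bullet> p))"
  define k where "k = (a \<bullet> p + a \<bullet> q) / 2 - m * (b \<bullet> p)"
  have mid1: "2 * (m * (b \<bullet> p) + k) = a \<bullet> p + a \<bullet> q" by (simp add: k_def)
  have "2 * (m * (b \<bullet> c) + k) = 2 * (b \<bullet> c - b \<bullet> p) * m + (a \<bullet> p + a \<bullet> q)"
    by (simp add: k_def algebra_simps)
  also have "\<dots> = a \<bullet> c + a \<bullet> d" using distinct by (simp add: m_def)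
  finally have mid2: "2 * (m * (b \<bullet> c) + k) = a \<bullet> c + a \<bullet> d" .
  let ?\<sigma> = "skew_reflection a b m k"
  have "?\<sigma> p = q" "?\<sigma> q = p" "?\<sigma> c = d" "?\<sigma> d = c"
    by (rule skew_reflection_swap[OF ab]; use level mid1 mid2 in simp)+
  then have "?\<sigma> ` {p, q, c, d} = {p, q, c, d}" by auto
  then have "?\<sigma> ` Q = Q" using hull skew_reflection_convex_hull by metis
  then have inv: "?\<sigma> x \<in> Q" if "x \<in> Q" for x using that by blast
  show ?thesis
  proof (cases "m \<ge> 0")
    case True
    then have "skew_symmetric_body Q a b m k"
      using Q assms(2) ab inv by unfold_locales
    then show ?thesis by blast
  next
    \<comment> \<open>Reversing \<open>a\<close> describes the same reflection with
      \<open>- m\<close> and \<open>- k\<close>, which restores the sign condition.\<close>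
    case False
    then have "skew_symmetric_body Q (- a) b (- m) (- k)"
      using Q assms(2) ab inv by unfold_locales (simp_all add: skew_reflection_minus)
    then show ?thesis by blast
  qed
qed

theorem corollary7p3:
  fixes Q :: "(real^2) set" and t :: real
  assumes "trapezoid Q"
    and "measure lebesgue Q = 1"
    and "0 \<le> t" and "t \<le> 1/4"
  shows "\<exists>L M Rs. orthogonal_lines L M \<and> cyclic_quadrants L M Rs \<and>
           map (\<lambda>R. measure lebesgue (Q \<inter> R)) Rs = [t, t, 1/2 - t, 1/2 - t]"
  using trapezoid_skew_symmetric[OF assms(1,2)] skew_symmetric_body.partition_exists[OF _ assms(3,4)]
  by blast

end
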